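(* Let $G=(V,E)$ be a finite graph and $z$ a positive integer. Then $$ M_q(G,z)=\sum_{A\subseteq E} (-1)^{|A|} \prod_{W\in C(A)} (z)_{q^{|W|}}. $$
   Context: For a graph $G=(V,E)$ with $V=\{1,\dots,k\}$ and a positive integer $n$, $V(G,n)$ is the set of vectors $(v_1,\dots,v_k)$ with $0\le v_i\le n-1$ for all $i$ and $v_i\neq v_j$ whenever $\{i,j\}\in E$, and $M_q(G,n)=\sum_{(v_1,\dots,v_k)\in V(G,n)} q^{\sum_i v_i}$ (the $q$-chromatic function). For $A\subseteq E$, $C(A)$ is the set of connected components of the spanning subgraph $(V,A)$ (isolated vertices count as components), and $|W|$ is the number of vertices of a component $W$. For an integer $m$, $(m)_q=\frac{q^m-1}{q-1}$; thus $(z)_{q^{|W|}}=\frac{q^{|W|z}-1}{q^{|W|}-1}=\sum_{x=0}^{z-1}q^{|W|x}$. *)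

theory Defs
  imports Complex_Main "HOL-Library.FuncSet"
begin

(* Finite simple graphs: edges are two-element sets of vertices. *)
definition finite_graph :: "'v set \<Rightarrow> 'v set set \<Rightarrow> bool" where
  "finite_graph V E \<longleftrightarrow> finite V \<and> E \<subseteq> {e. e \<subseteq> V \<and> card e = 2}"

(* Vectors (v_i) indexed by V are functions with value "undefined" outside V, so that
   distinct functions are distinct vectors. *)
definition proper_vectors :: "'v set \<Rightarrow> 'v set set \<Rightarrow> nat \<Rightarrow> ('v \<Rightarrow> nat) set" where
  "proper_vectors V E n =
     {v \<in> V \<rightarrow>\<^sub>E {0..<n}. \<forall>i\<in>V. \<forall>j\<in>V. {i, j} \<in> E \<longrightarrow> v i \<noteq> v j}"

definition q_chromatic :: "'a::field \<Rightarrow> 'v set \<Rightarrow> 'v set set \<Rightarrow> nat \<Rightarrow> 'a" where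
  "q_chromatic q V E n = (\<Sum>v\<in>proper_vectors V E n. q ^ (\<Sum>i\<in>V. v i))"

(* The equivalence relation "joined by a path in the spanning subgraph (V, A)"; paths of
   length 0 are included, so isolated vertices form components. *)
definition path_rel :: "'v set \<Rightarrow> 'v set set \<Rightarrow> 'v rel" where
  "path_rel V A = {(u, w). {u, w} \<in> A}\<^sup>* \<inter> V \<times> V"

(* Components are represented by their vertex sets. *)
definition components :: "'v set \<Rightarrow> 'v set set \<Rightarrow> 'v set set" where
  "components V A = V // path_rel V A"

(* The q-integer (m)_q = (q^m - 1) / (q - 1). In Isabelle x / 0 = 0, so the removable
   singularity at q = 1 is filled in with the usual value m; without this, the case where
   q is a root of unity would be wrong. *)
definition q_integer :: "'a::field \<Rightarrow> int \<Rightarrow> 'a" where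
  "q_integer q m = (if q = 1 then of_int m else (q powi m - 1) / (q - 1))"

end

(* Expanding the product of 1 - [v is constant on e] over all edges e turns the sum over proper
   vectors into a signed sum over A \<subseteq> E of sums over the vectors constant on every edge of A,
   that is, on every component of (V, A).  Such a vector is an arbitrary choice of one value x per
   component W, which contributes the factor q^(|W| x), so the inner sum is a product of geometric
   sums. *)
theory Submission
  imports Defs
begin

lemma equiv_path_rel: "equiv V (path_rel V A)"
proof (rule equivI)
  have "sym {(u, w). {u, w} \<in> A}"
    by (auto simp: sym_def insert_commute)
  then have "sym ({(u, w). {u, w} \<in> A}\<^sup>*)"
    by (rule sym_rtrancl)
  then show "sym (path_rel V A)"
    by (auto simp: path_rel_def sym_def)
  show "trans (path_rel V A)"
    by (auto simp: path_rel_def trans_def intro: rtrancl_trans)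
qed (auto simp: path_rel_def refl_on_def)

text \<open>The two ends of an edge are joined by a path of length one; conversely, equality of
  values propagates along a path by induction on its length.\<close>

lemma respects_path_rel_iff:
  assumes "A \<subseteq> {e. e \<subseteq> V \<and> card e = 2}"
  shows "v respects (path_rel V A) \<longleftrightarrow> (\<forall>e\<in>A. \<forall>i\<in>e. \<forall>j\<in>e. v i = v j)"
proof
  assume resp: "v respects (path_rel V A)"
  show "\<forall>e\<in>A. \<forall>i\<in>e. \<forall>j\<in>e. v i = v j"
  proof (intro ballI)
    fix e i j assume *: "e \<in> A" "i \<in> e" "j \<in> e"
    show "v i = v j"
    proof (cases "i = j")
      \<comment> \<open>Two distinct members exhaust a two-element edge, so \<open>i\<close> and
        \<open>j\<close> are its ends; \<open>e \<subseteq> V\<close> is there because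
        \<open>path_rel\<close> is cut down to pairs in \<open>V\<close>.\<close>
      case False
      with * assms have "e = {i, j}" "e \<subseteq> V"
        by (auto simp: card_2_iff)
      with * have "(i, j) \<in> path_rel V A"
        by (auto simp: path_rel_def)
      with resp show ?thesis
        by (rule congruentD)
    qed simp
  qed
next
  assume const: "\<forall>e\<in>A. \<forall>i\<in>e. \<forall>j\<in>e. v i = v j"
  have "v i = v j" if "(i, j) \<in> {(u, w). {u, w} \<in> A}\<^sup>*" for i j
    using that by (induction rule: rtrancl_induct) (use const in auto)
  then show "v respects (path_rel V A)"
    by (auto simp: path_rel_def intro!: congruentI)
qed

text \<open>A vector constant on classes is the same datum as a free choice of one value per class.
  The inverse map reads off the value at a chosen representative of each class.\<close>

lemma bij_betw_PiE_quotient: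
  assumes "equiv V R"
  shows "bij_betw (\<lambda>g. \<lambda>i\<in>V. g (R `` {i})) (V // R \<rightarrow>\<^sub>E S) {v \<in> V \<rightarrow>\<^sub>E S. v respects R}"
proof (rule bij_betwI[where g = "\<lambda>v. \<lambda>W\<in>V // R. v (SOME i. i \<in> W)"])
  \<comment> \<open>By reflexivity the class of \<open>i\<close> is nonempty, so \<open>SOME\<close>
    really picks a member of it.\<close>
  have some_class: "(i, SOME j. j \<in> R `` {i}) \<in> R" if "i \<in> V" for i
    using equiv_class_self[OF assms that] someI_ex[of "\<lambda>j. j \<in> R `` {i}"] by blast
  have some_mem: "(SOME j. j \<in> W) \<in> V" "R `` {SOME j. j \<in> W} = W" if "W \<in> V // R" for W
  proof -
    from that obtain i where i: "i \<in> V" "W = R `` {i}"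
      by (rule quotientE)
    show "(SOME j. j \<in> W) \<in> V" "R `` {SOME j. j \<in> W} = W"
      using some_class[OF i(1)] equiv_type[OF assms] equiv_class_eq[OF assms] i(2) by blast+
  qed
  show "(\<lambda>g. \<lambda>i\<in>V. g (R `` {i})) \<in> (V // R \<rightarrow>\<^sub>E S) \<rightarrow> {v \<in> V \<rightarrow>\<^sub>E S. v respects R}"
    using equiv_class_eq_iff[OF assms] by (auto simp: quotientI congruent_def)
  show "(\<lambda>v. \<lambda>W\<in>V // R. v (SOME i. i \<in> W)) \<in> {v \<in> V \<rightarrow>\<^sub>E S. v respects R} \<rightarrow> (V // R \<rightarrow>\<^sub>E S)"
    using some_mem(1) by auto
  show "(\<lambda>W\<in>V // R. (\<lambda>i\<in>V. g (R `` {i})) (SOME i. i \<in> W)) = g" if "g \<in> V // R \<rightarrow>\<^sub>E S" for g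
    using that some_mem by (intro PiE_ext[of _ "V // R" "\<lambda>_. S" g]) auto
  show "(\<lambda>i\<in>V. (\<lambda>W\<in>V // R. v (SOME i. i \<in> W)) (R `` {i})) = v"
    if "v \<in> {v \<in> V \<rightarrow>\<^sub>E S. v respects R}" for v
  proof
    fix i
    show "(\<lambda>i\<in>V. (\<lambda>W\<in>V // R. v (SOME i. i \<in> W)) (R `` {i})) i = v i"
    proof (cases "i \<in> V")
      case True
      then show ?thesis
        using that congruentD[OF _ some_class[OF True], of v] by (simp add: quotientI)
    next
      case False
      then show ?thesis
        using that by (auto simp: PiE_def extensional_def)
    qed
  qed
qed

text \<open>The classes partition \<open>V\<close>, and the summand is constant on each of
  them.\<close>

lemma sum_over_quotient:
  fixes g :: "'v set \<Rightarrow> 'b::comm_semiring_1"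
  assumes "finite V" "equiv V R"
  shows "(\<Sum>i\<in>V. g (R `` {i})) = (\<Sum>W\<in>V // R. of_nat (card W) * g W)"
proof -
  have "(\<Sum>i\<in>V. g (R `` {i})) = (\<Sum>i\<in>\<Union>(V // R). g (R `` {i}))"
    by (simp add: Union_quotient[OF assms(2)])
  also have "\<dots> = (\<Sum>W\<in>V // R. \<Sum>i\<in>W. g (R `` {i}))"
    using finite_equiv_class[OF assms(1) equiv_type[OF assms(2)]] quotient_disj[OF assms(2)]
    by (subst sum.Union_disjoint) auto
  also have "\<dots> = (\<Sum>W\<in>V // R. \<Sum>i\<in>W. g W)"
  proof (intro sum.cong refl arg_cong[of _ _ g])
    fix W i assume "W \<in> V // R" "i \<in> W"
    then show "R `` {i} = W"
      using equiv_class_eq[OF assms(2)] by (auto elim!: quotientE)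
  qed
  finally show ?thesis
    by simp
qed

text \<open>In terms of one value \<open>g W\<close> per class, the exponent is the sum of
  \<open>card W * g W\<close>, so the weight factors over the classes. Distributivity then turns the
  sum over all choices \<open>g\<close> into a product of sums.\<close>

lemma sum_power_respects:
  fixes q :: "'a::comm_semiring_1"
  assumes "finite V" "equiv V R" "finite S"
  shows "(\<Sum>v | v \<in> V \<rightarrow>\<^sub>E S \<and> v respects R. q ^ (\<Sum>i\<in>V. v i)) =
    (\<Prod>W\<in>V // R. \<Sum>x\<in>S. (q ^ card W) ^ x)"
proof -
  have "(\<Sum>v | v \<in> V \<rightarrow>\<^sub>E S \<and> v respects R. q ^ (\<Sum>i\<in>V. v i)) =
      (\<Sum>g\<in>V // R \<rightarrow>\<^sub>E S. q ^ (\<Sum>i\<in>V. g (R `` {i})))"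
    by (subst sum.reindex_bij_betw[OF bij_betw_PiE_quotient[OF assms(2)], symmetric])
      (auto intro!: sum.cong arg_cong[of _ _ "(^) q"])
  also have "\<dots> = (\<Sum>g\<in>V // R \<rightarrow>\<^sub>E S. \<Prod>W\<in>V // R. (q ^ card W) ^ g W)"
    by (simp add: sum_over_quotient[OF assms(1,2)] power_sum power_mult)
  also have "\<dots> = (\<Prod>W\<in>V // R. \<Sum>x\<in>S. (q ^ card W) ^ x)"
    using finite_quotient[OF assms(1) equiv_type[OF assms(2)]] assms(3)
    by (subst prod_sum_PiE) auto
  finally show ?thesis .
qed

text \<open>At \<open>q = 1\<close> both sides are \<open>n\<close>, so this also covers a root of
  unity \<open>q\<close> for which some \<open>q ^ card W\<close> equals 1.\<close>

lemma q_integer_of_nat: "q_integer q (int n) = (\<Sum>x<n. q ^ x)"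
  by (simp add: q_integer_def power_int_def geometric_sum)

theorem theorem1p2:
  fixes V :: "'v set" and E :: "'v set set" and z :: nat and q :: "'a::field"
  assumes "finite_graph V E" and "z > 0"
  shows "q_chromatic q V E z =
    (\<Sum>A\<in>Pow E. (- 1) ^ card A * (\<Prod>W\<in>components V A. q_integer (q ^ card W) (int z)))"
proof -
  have fin: "finite V" and E: "E \<subseteq> {e. e \<subseteq> V \<and> card e = 2}"
    using assms(1) by (auto simp: finite_graph_def)
  have finE: "finite E"
    using fin E by (intro finite_subset[of E "Pow V"]) auto
  let ?F = "V \<rightarrow>\<^sub>E {..<z}"
  let ?wt = "\<lambda>v. q ^ (\<Sum>i\<in>V. v i)"
  \<comment> \<open>With \<open>v\<close> read as a colouring, \<open>mono v e\<close> says that the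
    edge is monochromatic.\<close>
  define mono where "mono v e \<longleftrightarrow> (\<forall>i\<in>e. \<forall>j\<in>e. v i = v j)" for v :: "'v \<Rightarrow> nat" and e
  have finF: "finite ?F"
    using fin by (intro finite_PiE) auto
  have proper: "proper_vectors V E z = {v \<in> ?F. \<forall>e\<in>E. \<not> mono v e}"
  proof -
    have "(\<forall>i\<in>V. \<forall>j\<in>V. {i, j} \<in> E \<longrightarrow> v i \<noteq> v j) \<longleftrightarrow> (\<forall>e\<in>E. \<not> mono v e)" for v
    proof
      assume *: "\<forall>i\<in>V. \<forall>j\<in>V. {i, j} \<in> E \<longrightarrow> v i \<noteq> v j"
      show "\<forall>e\<in>E. \<not> mono v e"
      proof
        fix e assume "e \<in> E"
        moreover from this E obtain i j where "e = {i, j}" "e \<subseteq> V"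
          by (force simp: card_2_iff)
        ultimately show "\<not> mono v e"
          using * by (auto simp: mono_def)
      qed
    qed (auto simp: mono_def)
    then show ?thesis
      by (simp add: proper_vectors_def lessThan_atLeast0)
  qed
  have "q_chromatic q V E z = (\<Sum>v\<in>?F. of_bool (\<forall>e\<in>E. \<not> mono v e) * ?wt v)"
    unfolding q_chromatic_def proper using finF
    by (intro sum.mono_neutral_cong_left) auto
  also have "\<dots> = (\<Sum>v\<in>?F. (\<Prod>e\<in>E. 1 - of_bool (mono v e)) * ?wt v)"
    \<comment> \<open>A single monochromatic edge makes a factor, hence the product, vanish;
      otherwise every factor is 1.\<close>
    using finE by (intro sum.cong refl arg_cong2[of _ _ _ _ "(*)"]) (auto simp: prod_zero_iff)
  also have "\<dots> = (\<Sum>v\<in>?F. \<Sum>A\<in>Pow E. (- 1) ^ card A * (of_bool (\<forall>e\<in>A. mono v e) * ?wt v))"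
  proof -
    have "(\<Prod>e\<in>A. of_bool (mono v e)) = (of_bool (\<forall>e\<in>A. mono v e) :: 'a)" if "A \<in> Pow E" for A v
      using finite_subset[of A E] that finE by (auto simp: prod_zero_iff)
    then show ?thesis
      using finE
      \<comment> \<open>\<open>A\<close> collects the edges from which the indicator is taken, each
        with a sign; the others contribute 1. The deleted rules would turn the indicators into
        restricted index sets.\<close>
      by (simp add: prod_diff_conv_sum sum_distrib_right mult.assoc
          del: sum_mult_of_bool_eq sum_of_bool_mult_eq)
  qed
  also have "\<dots> = (\<Sum>A\<in>Pow E. (- 1) ^ card A * (\<Sum>v\<in>?F. of_bool (\<forall>e\<in>A. mono v e) * ?wt v))"
    by (subst sum.swap) (simp add: sum_distrib_left)
  also have "\<dots> = (\<Sum>A\<in>Pow E. (- 1) ^ card A *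
      (\<Prod>W\<in>components V A. q_integer (q ^ card W) (int z)))"
  proof (intro sum.cong refl arg_cong2[of _ _ _ _ "(*)"])
    fix A assume "A \<in> Pow E"
    with E have "v respects (path_rel V A) \<longleftrightarrow> (\<forall>e\<in>A. mono v e)" for v :: "'v \<Rightarrow> nat"
      by (subst respects_path_rel_iff) (auto simp: mono_def)
    \<comment> \<open>The indicator vanishes exactly at the vectors that are not constant on the
      components of \<open>(V, A)\<close>.\<close>
    then have "(\<Sum>v\<in>?F. of_bool (\<forall>e\<in>A. mono v e) * ?wt v) =
        (\<Sum>v | v \<in> ?F \<and> v respects (path_rel V A). ?wt v)"
      using finF by (intro sum.mono_neutral_cong_right) auto
    also have "\<dots> = (\<Prod>W\<in>components V A. q_integer (q ^ card W) (int z))"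
      by (simp add: sum_power_respects fin equiv_path_rel components_def q_integer_of_nat)
    finally show "(\<Sum>v\<in>?F. of_bool (\<forall>e\<in>A. mono v e) * ?wt v) =
        (\<Prod>W\<in>components V A. q_integer (q ^ card W) (int z))" .
  qed
  finally show ?thesis .
qed

end
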